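(* Let $m,n\ge 1$ be integers, let $W=[w_{j,i}]\in\mathbb{R}_+^{m\times n}$ be a matrix with nonnegative entries, and let $\mathbf{X}=(X_1,\dots,X_m)$ and $\mathbf{Y}=(Y_1,\dots,Y_n)$ be vectors with $X_j>0$ for all $j$ and $Y_i>0$ for all $i$. Consider the networked defense weakest-link game $\mathrm{NDWL}(W,\mathbf{X},\mathbf{Y})$, with strategy sets $\mathcal{F}_{\mathcal{X}}(\mathbf{X})$, $\mathcal{F}_{\mathcal{Y}}(\mathbf{Y})$ and defender payoff $\pi_{\mathcal{X}}(F_{\mathcal{X}},F_{\mathcal{Y}})$. For $p\in\Delta^n$ and $S\in\mathcal{S}$ define $$g(p,S):=\sum_{i=1}^n p_i^2\,\frac{z_i(S)}{Y_i},\qquad z_i(S):=\sum_{j=1}^m w_{j,i}X_j s_{j,i},$$ and $$g^\star:=\min_{p\in\Delta^n}\max_{S\in\mathcal{S}} g(p,S),\qquad \mathrm{UB}:=\begin{cases}\dfrac{g^\star}{2}, & g^\star\le 1,\\[6pt] 1-\dfrac{1}{2g^\star}, & g^\star\ge 1.\end{cases}$$ Then the defender's min-max value satisfies $$\inf_{F_{\mathcal{Y}}\in\mathcal{F}_{\mathcal{Y}}(\mathbf{Y})}\ \sup_{F_{\mathcal{X}}\in\mathcal{F}_{\mathcal{X}}(\mathbf{X})}\ \pi_{\mathcal{X}}(F_{\mathcal{X}},F_{\mathcal{Y}})\ \le\ \mathrm{UB}.$$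
   Context: The game $\mathrm{NDWL}(W,\mathbf{X},\mathbf{Y})$ is played between a defender $\mathcal{X}$ with $m$ resource types (budgets $X_1,\dots,X_m>0$) and an attacker $\mathcal{Y}$ with $n$ attack types (budgets $Y_1,\dots,Y_n>0$). The entry $w_{j,i}\ge 0$ is the effectiveness of defender resource type $j$ against attack type $i$. A defender allocation is a matrix $\boldsymbol{x}=(x_{i,j})_{1\le i\le n,\,1\le j\le m}\in\mathbb{R}_+^{n\times m}$, where $x_{i,j}$ is the amount of resource type $j$ used against attack type $i$. An attacker allocation is a vector $y=(y_1,\dots,y_n)\in\mathbb{R}_+^n$. Here $\mathbb{R}_+=[0,\infty)$. Mixed strategies: $\mathcal{F}_{\mathcal{X}}(\mathbf{X})$ is the set of all probability distributions $F_{\mathcal{X}}$ on $\mathbb{R}_+^{n\times m}$ with $\mathbb{E}_{\boldsymbol{x}\sim F_{\mathcal{X}}}\big[\sum_{i=1}^n x_{i,j}\big]=X_j$ for every $j=1,\dots,m$. $\mathcal{F}_{\mathcal{Y}}(\mathbf{Y})$ is the set of all probability distributions $F_{\mathcal{Y}}$ on $\mathbb{R}_+^n$ with $\mathbb{E}_{y\sim F_{\mathcal{Y}}}[y_i]=Y_i$ for every $i=1,\dots,n$. The defender's expected payoff, with $\boldsymbol{x}\sim F_{\mathcal{X}}$ and $y\sim F_{\mathcal{Y}}$ drawn independently, is $$\pi_{\mathcal{X}}(F_{\mathcal{X}},F_{\mathcal{Y}})=\mathbb{E}_{\boldsymbol{x}\sim F_{\mathcal{X}},\,y\sim F_{\mathcal{Y}}}\Big[\mathbf{1}\Big\{\sum_{j=1}^m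 w_{j,i}x_{i,j}\ge y_i\ \ \forall i=1,\dots,n\Big\}\Big].$$ $\Delta^n$ denotes the probability simplex $\{p\in\mathbb{R}_+^n:\sum_{i=1}^n p_i=1\}$. The set of routing matrices is $\mathcal{S}:=\{S=[s_{j,i}]\in\mathbb{R}_+^{m\times n}:\ \sum_{i=1}^n s_{j,i}=1\ \ \forall j=1,\dots,m\}$. *)

theory Defs
  imports "HOL-Probability.Probability"
begin

text \<open>
  The type \<open>'m\<close> indexes the defender's resource types and \<open>'n\<close> the attack types; both are finite
  and, like every type, nonempty, so the numbers of types are arbitrary integers at least 1.
  Following the usual row/column reading of matrices, \<open>W $ j $ i\<close> is the effectiveness of
  resource \<open>j\<close> against attack \<open>i\<close>, and \<open>x $ i $ j\<close> is the amount of resource \<open>j\<close> used against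
  attack \<open>i\<close>.
\<close>

text \<open>
  A probability distribution on the nonnegative orthant is represented by a Borel probability
  measure on the whole space that is almost surely nonnegative. Integrability is required
  explicitly because the Bochner integral of a non-integrable function is 0.
\<close>

definition defender_strategies :: "real ^ 'm \<Rightarrow> (real ^ 'm ^ 'n) measure set" where
  "defender_strategies X =
    {F. prob_space F \<and> sets F = sets borel \<and>
        (AE x in F. \<forall>i j. 0 \<le> x $ i $ j) \<and>
        (\<forall>j. integrable F (\<lambda>x. \<Sum>i\<in>UNIV. x $ i $ j) \<and>
             (LINT x|F. (\<Sum>i\<in>UNIV. x $ i $ j)) = X $ j)}"

definition attacker_strategies :: "real ^ 'n \<Rightarrow> (real ^ 'n) measure set" where
  "attacker_strategies Y =
    {F. prob_space F \<and> sets F = sets borel \<and>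
        (AE y in F. \<forall>i. 0 \<le> y $ i) \<and>
        (\<forall>i. integrable F (\<lambda>y. y $ i) \<and> (LINT y|F. y $ i) = Y $ i)}"

definition defender_wins :: "real ^ 'n ^ 'm \<Rightarrow> ((real ^ 'm ^ 'n) \<times> (real ^ 'n)) set" where
  "defender_wins W = {(x, y). \<forall>i. (\<Sum>j\<in>UNIV. W $ j $ i * x $ i $ j) \<ge> y $ i}"

definition defender_payoff ::
  "real ^ 'n ^ 'm \<Rightarrow> (real ^ 'm ^ 'n) measure \<Rightarrow> (real ^ 'n) measure \<Rightarrow> real" where
  "defender_payoff W FX FY = (LINT z|(FX \<Otimes>\<^sub>M FY). indicator (defender_wins W) z)"

definition min_max_value :: "real ^ 'n ^ 'm \<Rightarrow> real ^ 'm \<Rightarrow> real ^ 'n \<Rightarrow> real" where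
  "min_max_value W X Y =
    (INF FY\<in>attacker_strategies Y. SUP FX\<in>defender_strategies X. defender_payoff W FX FY)"

definition prob_simplex :: "(real ^ 'n) set" where
  "prob_simplex = {p. (\<forall>i. 0 \<le> p $ i) \<and> (\<Sum>i\<in>UNIV. p $ i) = 1}"

definition routing_matrices :: "(real ^ 'n ^ 'm) set" where
  "routing_matrices = {S. (\<forall>j i. 0 \<le> S $ j $ i) \<and> (\<forall>j. (\<Sum>i\<in>UNIV. S $ j $ i) = 1)}"

definition routed :: "real ^ 'n ^ 'm \<Rightarrow> real ^ 'm \<Rightarrow> real ^ 'n ^ 'm \<Rightarrow> 'n \<Rightarrow> real" where
  "routed W X S i = (\<Sum>j\<in>UNIV. W $ j $ i * X $ j * S $ j $ i)"

definition g ::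
  "real ^ 'n ^ 'm \<Rightarrow> real ^ 'm \<Rightarrow> real ^ 'n \<Rightarrow> real ^ 'n \<Rightarrow> real ^ 'n ^ 'm \<Rightarrow> real" where
  "g W X Y p S = (\<Sum>i\<in>UNIV. (p $ i)\<^sup>2 * (routed W X S i / Y $ i))"

definition g_star :: "real ^ 'n ^ 'm \<Rightarrow> real ^ 'm \<Rightarrow> real ^ 'n \<Rightarrow> real" where
  "g_star W X Y = (INF p\<in>prob_simplex. SUP S\<in>routing_matrices. g W X Y p S)"

definition UB :: "real ^ 'n ^ 'm \<Rightarrow> real ^ 'm \<Rightarrow> real ^ 'n \<Rightarrow> real" where
  "UB W X Y =
    (if g_star W X Y \<le> 1 then g_star W X Y / 2 else 1 - 1 / (2 * g_star W X Y))"

text \<open>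
  All infima and suprema above are taken over nonempty sets of real numbers that are bounded on
  the relevant side, and those defining \<^const>\<open>g_star\<close> are attained, i.e. they are a minimum and
  maxima. This is what the following lemmas establish.
\<close>

lemma defender_strategies_nonempty:
  fixes X :: "real ^ 'm"
  assumes "\<And>j. X $ j > 0"
  shows "(defender_strategies X :: (real ^ 'm ^ 'n) measure set) \<noteq> {}"
proof -
  define x :: "real ^ 'm ^ 'n" where "x = (\<chi> i j. X $ j / real CARD('n))"
  have meas: "(\<lambda>x::real ^ 'm ^ 'n. \<Sum>i\<in>UNIV. x $ i $ j) \<in> borel_measurable borel" for j
    by (intro borel_measurable_continuous_onI continuous_intros)
  have "return borel x \<in> defender_strategies X"
    unfolding defender_strategies_def
  proof (intro CollectI conjI allI)
    show "prob_space (return borel x)" by (simp add: prob_space_return)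
    show "AE x in return borel x. \<forall>i j. 0 \<le> x $ i $ j"
    proof (subst AE_return)
      have "closed {x::real ^ 'm ^ 'n. \<forall>i j. 0 \<le> x $ i $ j}"
        by (intro closed_Collect_all closed_Collect_le continuous_intros)
      then show "Measurable.pred borel (\<lambda>x::real ^ 'm ^ 'n. \<forall>i j. 0 \<le> x $ i $ j)"
        by (simp add: pred_def)
    qed (use assms in \<open>auto simp: x_def intro: less_imp_le\<close>)
    fix j
    show "(LINT x|return borel x. (\<Sum>i\<in>UNIV. x $ i $ j)) = X $ j"
      using meas[of j] by (subst integral_return) (auto simp: x_def)
    show "integrable (return borel x) (\<lambda>x. \<Sum>i\<in>UNIV. x $ i $ j)"
      using meas[of j] by (intro integrableI_bounded) (auto simp: nn_integral_return)
  qed simp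
  then show ?thesis by blast
qed

lemma attacker_strategies_nonempty:
  fixes Y :: "real ^ 'n"
  assumes "\<And>i. Y $ i > 0"
  shows "attacker_strategies Y \<noteq> {}"
proof -
  have meas: "(\<lambda>y::real ^ 'n. y $ i) \<in> borel_measurable borel" for i
    by (intro borel_measurable_continuous_onI continuous_intros)
  have "return borel Y \<in> attacker_strategies Y"
    unfolding attacker_strategies_def
  proof (intro CollectI conjI allI)
    show "prob_space (return borel Y)" by (simp add: prob_space_return)
    show "AE y in return borel Y. \<forall>i. 0 \<le> y $ i"
    proof (subst AE_return)
      show "Measurable.pred borel (\<lambda>y::real ^ 'n. \<forall>i. 0 \<le> y $ i)"
        by measurable
    qed (use assms in \<open>auto intro: less_imp_le\<close>)
    fix i
    show "(LINT y|return borel Y. y $ i) = Y $ i"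
      using meas[of i] by (subst integral_return) auto
    show "integrable (return borel Y) (\<lambda>y. y $ i)"
      using meas[of i] by (intro integrableI_bounded) (auto simp: nn_integral_return)
  qed simp
  then show ?thesis by blast
qed

lemma defender_wins_measurable: "defender_wins W \<in> sets (borel \<Otimes>\<^sub>M borel)"
proof -
  have "closed (defender_wins W)"
    unfolding defender_wins_def case_prod_beta
    by (intro closed_Collect_all closed_Collect_le continuous_intros)
  then have "defender_wins W \<in> sets borel" by (rule borel_closed)
  then show ?thesis unfolding borel_prod .
qed

lemma defender_payoff_bounds:
  assumes "FX \<in> defender_strategies X" "FY \<in> attacker_strategies Y"
  shows "0 \<le> defender_payoff W FX FY" "defender_payoff W FX FY \<le> 1"
proof -
  interpret FX: prob_space FX using assms by (simp add: defender_strategies_def)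
  interpret FY: prob_space FY using assms by (simp add: attacker_strategies_def)
  interpret pair_prob_space FX FY ..
  have "sets (FX \<Otimes>\<^sub>M FY) = sets (borel \<Otimes>\<^sub>M borel)"
    using assms by (intro sets_pair_measure_cong)
      (auto simp: defender_strategies_def attacker_strategies_def)
  then have "defender_wins W \<in> sets (FX \<Otimes>\<^sub>M FY)"
    using defender_wins_measurable by simp
  then have "defender_payoff W FX FY = prob (defender_wins W)"
    by (simp add: defender_payoff_def sets.Int_space_eq2)
  then show "0 \<le> defender_payoff W FX FY" "defender_payoff W FX FY \<le> 1"
    by simp_all
qed

lemma prob_simplex_compact: "compact (prob_simplex :: (real ^ 'n) set)"
proof -
  have "closed (prob_simplex :: (real ^ 'n) set)"
    unfolding prob_simplex_def
    by (intro closed_Collect_conj closed_Collect_all closed_Collect_le closed_Collect_eq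
        continuous_intros)
  moreover have "norm p \<le> 1" if "p \<in> prob_simplex" for p :: "real ^ 'n"
    using that norm_le_l1_cart[of p] by (simp add: prob_simplex_def)
  ultimately show ?thesis
    by (auto simp: compact_eq_bounded_closed bounded_iff)
qed

lemma prob_simplex_nonempty: "(prob_simplex :: (real ^ 'n) set) \<noteq> {}"
proof -
  have "(\<chi> i. 1 / real CARD('n)) \<in> (prob_simplex :: (real ^ 'n) set)"
    by (simp add: prob_simplex_def)
  then show ?thesis by blast
qed

lemma routing_matrices_rows: "S \<in> routing_matrices \<longleftrightarrow> (\<forall>j. S $ j \<in> prob_simplex)"
  by (auto simp: routing_matrices_def prob_simplex_def)

lemma routing_matrices_nonempty: "(routing_matrices :: (real ^ 'n ^ 'm) set) \<noteq> {}"
proof -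
  obtain p :: "real ^ 'n" where "p \<in> prob_simplex" using prob_simplex_nonempty by blast
  then have "(\<chi> j. p) \<in> (routing_matrices :: (real ^ 'n ^ 'm) set)"
    by (simp add: routing_matrices_rows)
  then show ?thesis by blast
qed

lemma routing_matrices_compact: "compact (routing_matrices :: (real ^ 'n ^ 'm) set)"
proof -
  have "closed (routing_matrices :: (real ^ 'n ^ 'm) set)"
    unfolding routing_matrices_def
    by (intro closed_Collect_conj closed_Collect_all closed_Collect_le closed_Collect_eq
        continuous_intros)
  moreover have "norm S \<le> real CARD('m)" if "S \<in> routing_matrices" for S :: "real ^ 'n ^ 'm"
  proof -
    have "norm (S $ j) \<le> 1" for j
      using that norm_le_l1_cart[of "S $ j"]
      by (simp add: routing_matrices_def)
    then have "(\<Sum>j\<in>UNIV. norm (S $ j)) \<le> real CARD('m) * 1"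
      by (intro sum_bounded_above) auto
    moreover have "norm S \<le> (\<Sum>j\<in>UNIV. norm (S $ j))"
      unfolding norm_vec_def by (intro L2_set_le_sum) auto
    ultimately show ?thesis by simp
  qed
  ultimately show ?thesis
    by (auto simp: compact_eq_bounded_closed bounded_iff)
qed

lemma continuous_on_g_routing: "continuous_on A (g W X Y p)"
  unfolding g_def routed_def divide_inverse by (intro continuous_intros)

lemma continuous_on_g_simplex: "continuous_on A (\<lambda>p. g W X Y p S)"
  unfolding g_def by (intro continuous_intros)

lemma g_max_attained:
  "\<exists>S\<in>routing_matrices. g W X Y p S = (SUP S'\<in>routing_matrices. g W X Y p S') \<and>
     (\<forall>S'\<in>routing_matrices. g W X Y p S' \<le> g W X Y p S)"
proof -
  obtain S where S: "S \<in> routing_matrices" "\<forall>S'\<in>routing_matrices. g W X Y p S' \<le> g W X Y p S"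
    using continuous_attains_sup[OF routing_matrices_compact routing_matrices_nonempty
        continuous_on_g_routing] by blast
  then have "(SUP S'\<in>routing_matrices. g W X Y p S') = g W X Y p S"
    by (intro cSup_eq_maximum) auto
  with S show ?thesis by auto
qed

lemma g_star_attained:
  assumes W: "\<And>j i. W $ j $ i \<ge> 0" and X: "\<And>j. X $ j > 0" and Y: "\<And>i. Y $ i > 0"
  shows "\<exists>p\<in>prob_simplex. (SUP S\<in>routing_matrices. g W X Y p S) = g_star W X Y \<and>
     (\<forall>q\<in>prob_simplex. g_star W X Y \<le> (SUP S\<in>routing_matrices. g W X Y q S))"
proof -
  define G where "G p = (SUP S\<in>routing_matrices. g W X Y p S)" for p
  have upper: "g W X Y p S \<le> G p" if "S \<in> routing_matrices" for p S
    using g_max_attained[of W X Y p] that by (auto simp: G_def)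
  have nonneg: "0 \<le> g W X Y p S" if "S \<in> routing_matrices" for p S
    using that W X Y unfolding g_def routed_def
    by (auto intro!: sum_nonneg mult_nonneg_nonneg divide_nonneg_nonneg
        simp: routing_matrices_def less_imp_le)
  have "0 \<le> G p" for p
    using routing_matrices_nonempty nonneg upper by (meson all_not_in_conv order_trans)
  then have bdd: "bdd_below (G ` prob_simplex)" by (intro bdd_belowI[of _ 0]) auto
  have lower: "g_star W X Y \<le> G q" if "q \<in> prob_simplex" for q
    using bdd that unfolding g_star_def G_def[symmetric] by (rule cINF_lower)
  have "\<exists>p\<in>prob_simplex. G p < g_star W X Y + 1 / real (Suc k)" for k
  proof -
    have "(INF p\<in>prob_simplex. G p) < g_star W X Y + 1 / real (Suc k)"
      unfolding g_star_def G_def by simp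
    then show ?thesis
      using cINF_less_iff[OF prob_simplex_nonempty bdd] by blast
  qed
  then obtain P where P: "\<And>k. P k \<in> prob_simplex"
      "\<And>k. G (P k) < g_star W X Y + 1 / real (Suc k)" by metis
  obtain p r where p: "p \<in> prob_simplex" and r: "strict_mono (r :: nat \<Rightarrow> nat)"
    and lim: "(P \<circ> r) \<longlonglongrightarrow> p"
    using prob_simplex_compact P(1) unfolding compact_def by metis
  have "g W X Y p S \<le> g_star W X Y" if S: "S \<in> routing_matrices" for S
  proof (rule LIMSEQ_le)
    show "(\<lambda>k. g W X Y ((P \<circ> r) k) S) \<longlonglongrightarrow> g W X Y p S"
      using continuous_on_tendsto_compose[OF continuous_on_g_simplex[of UNIV] lim] by simp
    have "(\<lambda>k. 1 / real (Suc (r k))) \<longlonglongrightarrow> 0"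
      using LIMSEQ_subseq_LIMSEQ[OF LIMSEQ_Suc[OF lim_1_over_n] r] by (simp add: o_def)
    from tendsto_add[OF tendsto_const this]
    show "(\<lambda>k. g_star W X Y + 1 / real (Suc (r k))) \<longlonglongrightarrow> g_star W X Y" by simp
    show "\<exists>N. \<forall>k\<ge>N. g W X Y ((P \<circ> r) k) S \<le> g_star W X Y + 1 / real (Suc (r k))"
      using upper[OF S] P(2) by (metis comp_apply less_imp_le order_trans)
  qed
  then have "G p \<le> g_star W X Y"
    using routing_matrices_nonempty unfolding G_def by (intro cSUP_least) auto
  with p lower show ?thesis unfolding G_def by (metis order_antisym)
qed

end

theory Submission imports Defs begin

text \<open>
  Let \<open>p\<close> attain \<open>g_star\<close> and put \<open>c = max 1 g_star\<close>. The attacker draws a single target \<open>i\<close> with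
  probability \<open>p $ i\<close> and attacks it with \<open>t * Y $ i / p $ i\<close>, where \<open>t\<close> has mean 1: it is 0 with
  probability \<open>1 - 1 / c\<close> and uniform on \<open>{0..2 * c}\<close> otherwise. The distribution function of
  \<open>t\<close> lies below an affine function, so the defender's winning probability is at most affine in
  her effective allocation. Taking expectations, only the mean routing matters, and the bound
  becomes \<open>1 - 1 / c + g p S / (2 * c\<^sup>2)\<close>.
\<close>

text \<open>The law is the image of the uniform measure on \<open>{0..1}\<close> under its quantile
  function. The bound on \<open>{..a}\<close> is an equality up to \<open>a = 2 * c\<close>, where
  it reaches 1, and is trivial beyond.\<close>

lemma lotto_marginal_exists:
  fixes c :: real
  assumes c: "1 \<le> c"
  obtains T :: "real measure" where "prob_space T" "sets T = sets borel" "AE t in T. 0 \<le> t"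
    "integrable T (\<lambda>t. t)" "(LINT t|T. t) = 1"
    "\<And>a. 0 \<le> a \<Longrightarrow> measure T {..a} \<le> 1 - 1 / c + a / (2 * c\<^sup>2)"
proof -
  \<comment> \<open>\<open>f\<close> is the quantile function of the law of \<open>t\<close>.\<close>
  define U where "U = restrict_space lborel {0..1::real}"
  define f where "f u = max 0 (2 * c * (c * u - c + 1))" for u
  interpret U: prob_space U
    unfolding U_def by (intro prob_space_restrict_space) auto
  have [simp]: "space U = {0..1}" by (simp add: U_def space_restrict_space)
  have f: "f \<in> borel_measurable borel" unfolding f_def by measurable
  then have [measurable]: "f \<in> borel_measurable U"
    unfolding U_def by (intro measurable_restrict_space1) simp
  have int: "integrable U f"
  proof (rule U.integrable_const_bound)
    show "AE u in U. norm (f u) \<le> 2 * c"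
    proof (rule AE_I2)
      fix u assume "u \<in> space U"
      then have "c * u \<le> c * 1" using c by (intro mult_left_mono) auto
      then have "2 * c * (c * u - c + 1) \<le> 2 * c * 1" using c by (intro mult_left_mono) auto
      then show "norm (f u) \<le> 2 * c" using c by (auto simp: f_def)
    qed
  qed simp
  have mean: "(LINT u|U. f u) = 1"
  proof -
    \<comment> \<open>\<open>b\<close> is the mass of the atom at 0: on \<open>{0..1}\<close>,
      \<open>f\<close> vanishes up to \<open>b\<close> and is linear from there on.\<close>
    define b where "b = 1 - 1 / c"
    have b: "0 \<le> b" "b \<le> 1" using c by (auto simp: b_def)
    have "(LINT u|U. f u) = (LINT u|lborel. indicator {0..1} u *\<^sub>R f u)"
      unfolding U_def by (subst integral_restrict_space) auto
    also have "\<dots> = (LINT u|lborel. indicator {b..1} u *\<^sub>R (2 * c * (c * u - c + 1)))"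
    proof -
      have "indicator {0..1} u *\<^sub>R f u = indicator {b..1} u *\<^sub>R (2 * c * (c * u - c + 1))" for u
      proof -
        have "c * u - c + 1 = c * (u - b)" using c by (simp add: b_def field_simps)
        then have "f u = max 0 (2 * c * (c * (u - b)))" "2 * c * (c * u - c + 1) = 2 * c * (c * (u - b))"
          by (simp_all add: f_def)
        moreover have "0 \<le> 2 * c * (c * (u - b)) \<longleftrightarrow> b \<le> u"
          using c by (simp add: zero_le_mult_iff)
        ultimately show ?thesis using b by (auto simp: indicator_def)
      qed
      then show ?thesis by simp
    qed
    \<comment> \<open>The linear branch has the antiderivative
      \<open>(c * u - c + 1)\<^sup>2\<close>, which is 0 at \<open>b\<close> and 1 at 1.\<close>
    also have "\<dots> = (c * 1 - c + 1)\<^sup>2 - (c * b - c + 1)\<^sup>2"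
      using b(2)
    proof (rule integral_FTC_Icc)
      show "((\<lambda>u. (c * u - c + 1)\<^sup>2) has_vector_derivative 2 * c * (c * u - c + 1)) (at u within {b..1})" for u
        unfolding has_real_derivative_iff_has_vector_derivative[symmetric]
        by (auto intro!: derivative_eq_intros)
    qed (intro continuous_intros)
    also have "\<dots> = 1" using c by (simp add: b_def field_simps)
    finally show ?thesis .
  qed
  have cdf: "measure U ({u. f u \<le> a} \<inter> {0..1}) \<le> 1 - 1 / c + a / (2 * c\<^sup>2)" if a: "0 \<le> a" for a
  proof -
    \<comment> \<open>The linear branch takes the value \<open>a\<close> at \<open>d\<close>, so
      \<open>f u \<le> a\<close> forces \<open>u \<le> d\<close>. For large \<open>a\<close> this
      point lies beyond 1, hence \<open>min 1 d\<close> below.\<close>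
    define d where "d = 1 - 1 / c + a / (2 * c\<^sup>2)"
    have d: "0 \<le> d" unfolding d_def using c a by simp
    have "u \<le> d" if "f u \<le> a" for u
    proof -
      have "2 * c * (c * u - c + 1) \<le> a" using that by (simp add: f_def)
      also have "a = 2 * c * (c * d - c + 1)" using c by (simp add: d_def field_simps power2_eq_square)
      finally show ?thesis using c by simp
    qed
    moreover have "{u. f u \<le> a} \<in> sets borel"
      using measurable_sets[OF f, of "{..a}"] by (simp add: vimage_def)
    ultimately have "measure U ({u. f u \<le> a} \<inter> {0..1}) \<le> measure lborel {0..min 1 d}"
      unfolding U_def
      by (subst measure_restrict_space, simp, simp, intro measure_mono_fmeasurable)
        (auto simp: fmeasurable_def emeasure_lborel_Icc_eq)
    also have "measure lborel {0..min 1 d} \<le> d" using d by simp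
    finally show ?thesis by (simp add: d_def)
  qed
  show ?thesis
  proof (rule that[of "distr U borel f"])
    show "prob_space (distr U borel f)" by (rule U.prob_space_distr) simp
    show "AE t in distr U borel f. 0 \<le> t"
      by (subst AE_distr_iff) (auto simp: f_def)
    show "integrable (distr U borel f) (\<lambda>t. t)"
      using int by (subst integrable_distr_eq) auto
    show "(LINT t|distr U borel f. t) = 1"
      using mean by (subst integral_distr) auto
    show "measure (distr U borel f) {..a} \<le> 1 - 1 / c + a / (2 * c\<^sup>2)" if "0 \<le> a" for a
      using cdf[OF that] by (subst measure_distr) (auto simp: vimage_def)
  qed simp
qed

text \<open>Where \<open>p $ i\<close> is positive, dividing by it makes up for the chance that
  \<open>i\<close> is not the target and keeps the mean at \<open>Y $ i\<close>. If \<open>i\<close>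
  is drawn, a defence \<open>v\<close> holds only if \<open>t \<le> v i * p $ i / Y $ i\<close>. The
  slope thus carries one factor \<open>p $ i\<close>; the weight of the draw supplies the second,
  whence the square in \<open>g\<close>.\<close>

lemma attacker_strategy_exists:
  fixes Y p :: "real ^ 'n" and c :: real
  assumes Y: "\<And>i. Y $ i > 0" and p: "p \<in> prob_simplex" and c: "1 \<le> c"
  obtains F where "F \<in> attacker_strategies Y"
    "\<And>v. (\<And>i. 0 \<le> v i) \<Longrightarrow>
      measure F {y. \<forall>i. y $ i \<le> v i} \<le> 1 - 1 / c + (\<Sum>i\<in>UNIV. (p $ i)\<^sup>2 * (v i / Y $ i)) / (2 * c\<^sup>2)"
proof -
  obtain T :: "real measure" where T: "prob_space T" "sets T = sets borel" "AE t in T. 0 \<le> t"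
    "integrable T (\<lambda>t. t)" "(LINT t|T. t) = 1"
    "\<And>a. 0 \<le> a \<Longrightarrow> measure T {..a} \<le> 1 - 1 / c + a / (2 * c\<^sup>2)"
    using lotto_marginal_exists[OF c] by blast
  interpret T: prob_space T by fact
  note [simp, measurable_cong] = T(2)
  have [simp]: "space T = UNIV" using sets_eq_imp_space_eq[OF T(2)] by simp
  have p0: "0 \<le> p $ i" for i using p by (simp add: prob_simplex_def)
  have p1: "(\<Sum>i\<in>UNIV. p $ i) = 1" using p by (simp add: prob_simplex_def)
  define P where "P = embed_pmf (\<lambda>i. p $ i)"
  have P: "pmf P i = p $ i" for i
    unfolding P_def
    by (rule pmf_embed_pmf) (simp_all add: p0 p1 nn_integral_count_space_finite sum_ennreal)
  interpret PT: pair_prob_space "measure_pmf P" T ..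
  let ?M = "measure_pmf P \<Otimes>\<^sub>M T"
  \<comment> \<open>A target with \<open>p $ k = 0\<close> is never drawn, yet its mean must be \<open>Y $ k\<close>; attacking it
    with \<open>Y $ k\<close> always can only hurt the defender.\<close>
  define h :: "'n \<times> real \<Rightarrow> real ^ 'n" where
    "h z = (\<chi> k. if p $ k = 0 then Y $ k else if k = fst z then snd z * (Y $ k / p $ k) else 0)" for z
  have hk[measurable]: "(\<lambda>z. h z $ k) \<in> borel_measurable ?M" for k
    unfolding h_def by simp
  have h[measurable]: "h \<in> borel_measurable ?M"
    by (auto simp: borel_measurable_euclidean_space[of h] Basis_vec_def inner_axis)
  \<comment> \<open>Through this marginal, integrability and almost sure nonnegativity of
    \<open>t\<close> pass from \<open>T\<close> to the product.\<close>
  have distr_snd: "distr ?M T snd = T"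
  proof (rule measure_eqI)
    fix A assume "A \<in> sets (distr ?M T snd)"
    then have A: "A \<in> sets T" by simp
    then have "emeasure (distr ?M T snd) A = emeasure ?M (UNIV \<times> A)"
      by (subst emeasure_distr) (auto simp: space_pair_measure intro!: arg_cong[of _ _ "emeasure ?M"])
    also have "\<dots> = emeasure T A"
      using A by (simp add: T.emeasure_pair_measure_Times)
    finally show "emeasure (distr ?M T snd) A = emeasure T A" .
  qed simp
  have "integrable (distr ?M T snd) (\<lambda>t. t)"
    using T(4) by (simp add: distr_snd)
  then have snd_int: "integrable ?M snd"
    by (subst (asm) integrable_distr_eq) auto
  have int: "integrable ?M (\<lambda>z. h z $ k)" for k
  proof (rule Bochner_Integration.integrable_bound)
    \<comment> \<open>One dominating function serves all three cases in the definition of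
      \<open>h\<close>.\<close>
    show "integrable ?M (\<lambda>z. \<bar>Y $ k\<bar> + \<bar>Y $ k / p $ k\<bar> * \<bar>snd z\<bar>)"
      using snd_int by simp
    show "AE z in ?M. norm (h z $ k) \<le> norm (\<bar>Y $ k\<bar> + \<bar>Y $ k / p $ k\<bar> * \<bar>snd z\<bar>)"
      by (rule AE_I2) (auto simp: h_def abs_mult mult.commute)
  qed simp
  have mean: "(LINT z|?M. h z $ k) = Y $ k" for k
  proof -
    have inner: "(LINT t|T. h (i, t) $ k) = (if p $ k = 0 then Y $ k else if k = i then Y $ k / p $ k else 0)" for i
      using T(5) by (simp add: h_def T.prob_space[simplified])
    have "(LINT z|?M. h z $ k) = (LINT i|P. LINT t|T. h (i, t) $ k)"
      by (rule PT.integral_fst'[OF int, symmetric])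
    also have "\<dots> = (\<Sum>i\<in>UNIV. (if p $ k = 0 then Y $ k else if k = i then Y $ k / p $ k else 0) * p $ i)"
      unfolding inner by (subst integral_measure_pmf_real[of UNIV]) (auto simp: P)
    \<comment> \<open>For \<open>p $ k = 0\<close> a constant is averaged; otherwise only the draw
      \<open>i = k\<close> contributes, and its weight cancels the denominator
      \<open>p $ k\<close>.\<close>
    also have "\<dots> = Y $ k"
    proof (cases "p $ k = 0")
      case True
      then show ?thesis by (simp add: sum_distrib_left[symmetric] p1)
    next
      case False
      then show ?thesis by (simp add: if_distrib[of "\<lambda>x. x * _"] cong: if_cong)
    qed
    finally show ?thesis .
  qed
  define F where "F = distr ?M borel h"
  interpret F: prob_space F unfolding F_def by (rule PT.prob_space_distr) simp
  show ?thesis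
  proof (rule that[of F])
    show "F \<in> attacker_strategies Y"
      unfolding attacker_strategies_def
    proof (intro CollectI conjI allI)
      show "prob_space F" by unfold_locales
      show "sets F = sets borel" by (simp add: F_def)
      have "AE z in ?M. 0 \<le> snd z"
      proof -
        have "AE t in distr ?M T snd. 0 \<le> t"
          unfolding distr_snd by (rule T(3))
        then show ?thesis by (subst (asm) AE_distr_iff) auto
      qed
      then have "AE z in ?M. \<forall>i. 0 \<le> h z $ i"
        by eventually_elim (auto simp: h_def Y[THEN less_imp_le] p0)
      then show "AE y in F. \<forall>i. 0 \<le> y $ i"
        unfolding F_def by (subst AE_distr_iff) auto
      fix i
      show "integrable F (\<lambda>y. y $ i)"
        unfolding F_def using int by (subst integrable_distr_eq) auto
      show "(LINT y|F. y $ i) = Y $ i"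
        unfolding F_def using mean by (subst integral_distr) auto
    qed
    fix v :: "'n \<Rightarrow> real" assume v: "\<And>i. 0 \<le> v i"
    define A where "A = {z. \<forall>k. h z $ k \<le> v k}"
    have A[measurable]: "A \<in> sets ?M"
    proof -
      have "{z \<in> space ?M. \<forall>k. h z $ k \<le> v k} \<in> sets ?M" by measurable
      then show ?thesis by (simp add: A_def space_pair_measure)
    qed
    have "measure F {y. \<forall>i. y $ i \<le> v i} = measure ?M A"
      unfolding F_def by (subst measure_distr) (auto simp: A_def vimage_def space_pair_measure)
    also have "\<dots> = (LINT z|?M. indicator A z)"
      by (simp add: space_pair_measure)
    also have "\<dots> = (LINT i|P. LINT t|T. indicator A (i, t))"
      by (rule PT.integral_fst'[symmetric]) (simp add: PT.emeasure_eq_measure)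
    also have "\<dots> = (\<Sum>i\<in>UNIV. (LINT t|T. indicator A (i, t)) * p $ i)"
      by (subst integral_measure_pmf_real[of UNIV]) (auto simp: P)
    also have "\<dots> \<le> (\<Sum>i\<in>UNIV. (1 - 1 / c + v i * p $ i / Y $ i / (2 * c\<^sup>2)) * p $ i)"
    proof (rule sum_mono)
      fix i
      show "(LINT t|T. indicator A (i, t)) * p $ i \<le> (1 - 1 / c + v i * p $ i / Y $ i / (2 * c\<^sup>2)) * p $ i"
      \<comment> \<open>Targets of probability 0 add nothing to either side. For the others only the
        constraint at coordinate \<open>i\<close> is kept, which can only enlarge the event.\<close>
      proof (cases "p $ i = 0")
        case False
        then have pi: "0 < p $ i" using p0[of i] by simp
        have "t \<le> v i * p $ i / Y $ i" if "(i, t) \<in> A" for t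
        proof -
          have "t * (Y $ i / p $ i) \<le> v i" using that False by (auto simp: A_def h_def split: if_splits)
          then show ?thesis using pi Y[of i] by (simp add: field_simps)
        qed
        then have "measure T (Pair i -` A) \<le> measure T {..v i * p $ i / Y $ i}"
          by (intro T.finite_measure_mono) auto
        also have "\<dots> \<le> 1 - 1 / c + v i * p $ i / Y $ i / (2 * c\<^sup>2)"
          using v[of i] pi Y[of i] by (intro T(6)) simp
        finally have "measure T (Pair i -` A) \<le> 1 - 1 / c + v i * p $ i / Y $ i / (2 * c\<^sup>2)" .
        moreover have "(LINT t|T. indicator A (i, t)) = measure T (Pair i -` A)"
        proof -
          have "indicator A (i, t) = (indicator (Pair i -` A) t :: real)" for t
            by (simp add: indicator_def)
          then show ?thesis by simp
        qed
        ultimately show ?thesis by (intro mult_right_mono p0) simp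
      qed simp
    qed
    also have "\<dots> = 1 - 1 / c + (\<Sum>i\<in>UNIV. (p $ i)\<^sup>2 * (v i / Y $ i)) / (2 * c\<^sup>2)"
    proof -
      have "(1 - 1 / c + v i * p $ i / Y $ i / (2 * c\<^sup>2)) * p $ i
        = (1 - 1 / c) * p $ i + (p $ i)\<^sup>2 * (v i / Y $ i) / (2 * c\<^sup>2)" for i
        by (subst distrib_right) (simp add: power2_eq_square mult_ac)
      then show ?thesis
        by (simp only: sum.distrib sum_distrib_left[symmetric] sum_divide_distrib[symmetric] p1 mult_1_right)
    qed
    finally show "measure F {y. \<forall>i. y $ i \<le> v i} \<le> \<dots>" .
  qed
qed

text \<open>For fixed \<open>x\<close> the winning probability is bounded by an affine function of
  the effective defences, so averaging over \<open>FX\<close> replaces \<open>x\<close> by its mean.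
  The mean share of budget \<open>j\<close> spent on attack \<open>i\<close> is
  \<open>S $ j $ i\<close>; each row sums to 1 because the budget is met in expectation.\<close>

lemma defender_payoff_le_g:
  fixes W :: "real ^ 'n ^ 'm" and X :: "real ^ 'm"
  assumes W: "\<And>j i. W $ j $ i \<ge> 0" and X: "\<And>j. X $ j > 0"
    and FX: "FX \<in> defender_strategies X" and FY: "FY \<in> attacker_strategies Y"
    and bound: "\<And>v. (\<And>i. 0 \<le> v i) \<Longrightarrow>
      measure FY {y. \<forall>i. y $ i \<le> v i} \<le> a + b * (\<Sum>i\<in>UNIV. (p $ i)\<^sup>2 * (v i / Y $ i))"
  obtains S where "S \<in> routing_matrices" "defender_payoff W FX FY \<le> a + b * g W X Y p S"
proof -
  interpret FX: prob_space FX using FX by (simp add: defender_strategies_def)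
  interpret FY: prob_space FY using FY by (simp add: attacker_strategies_def)
  interpret pair_prob_space FX FY ..
  have [simp, measurable_cong]: "sets FX = sets borel" and [simp, measurable_cong]: "sets FY = sets borel"
    using FX FY by (simp_all add: defender_strategies_def attacker_strategies_def)
  have [simp]: "space FX = UNIV" "space FY = UNIV"
    using sets_eq_imp_space_eq[of FX borel] sets_eq_imp_space_eq[of FY borel] by simp_all
  have nonneg: "AE x in FX. \<forall>i j. 0 \<le> x $ i $ j"
    and sum_int: "integrable FX (\<lambda>x. \<Sum>i\<in>UNIV. x $ i $ j)"
    and sum_mean: "(LINT x|FX. (\<Sum>i\<in>UNIV. x $ i $ j)) = X $ j" for j
    using FX by (auto simp: defender_strategies_def)
  have [measurable]: "(\<lambda>x::real ^ 'm ^ 'n. x $ i $ j) \<in> borel_measurable borel" for i j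
    by (intro borel_measurable_continuous_onI continuous_intros)
  \<comment> \<open>Only the total over \<open>i\<close> is known to be integrable; by nonnegativity
    it dominates each entry.\<close>
  have int: "integrable FX (\<lambda>x. x $ i $ j)" for i j
  proof (rule Bochner_Integration.integrable_bound[OF sum_int[of j]])
    show "AE x in FX. norm (x $ i $ j) \<le> norm (\<Sum>i\<in>UNIV. x $ i $ j)"
      using nonneg
    proof eventually_elim
      case (elim x)
      then have "x $ i $ j \<le> (\<Sum>i\<in>UNIV. x $ i $ j)" by (intro member_le_sum) auto
      then show ?case using elim by (auto simp: sum_nonneg)
    qed
  qed simp
  define S :: "real ^ 'n ^ 'm" where "S = (\<chi> j i. (LINT x|FX. x $ i $ j) / X $ j)"
  have XS: "X $ j * S $ j $ i = (LINT x|FX. x $ i $ j)" for i j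
    using X[of j] by (simp add: S_def)
  have "0 \<le> S $ j $ i" for i j
  proof -
    have "AE x in FX. 0 \<le> x $ i $ j" using nonneg by eventually_elim simp
    then have "0 \<le> (LINT x|FX. x $ i $ j)" by (rule integral_nonneg_AE)
    then show ?thesis using X[of j] by (simp add: S_def)
  qed
  moreover have "(\<Sum>i\<in>UNIV. S $ j $ i) = 1" for j
    using sum_mean[of j] X[of j] int by (simp add: S_def sum_divide_distrib[symmetric] less_imp_neq[symmetric])
  ultimately have S: "S \<in> routing_matrices" by (simp add: routing_matrices_def)
  define v where "v x i = (\<Sum>j\<in>UNIV. W $ j $ i * x $ i $ j)" for x :: "real ^ 'm ^ 'n" and i
  have v_int: "integrable FX (\<lambda>x. v x i)" and v_mean: "(LINT x|FX. v x i) = routed W X S i" for i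
    using int by (simp_all add: v_def routed_def XS mult.assoc)
  have wins: "defender_wins W \<in> sets (FX \<Otimes>\<^sub>M FY)"
    using defender_wins_measurable[of W] by (simp cong: sets_pair_measure_cong)
  have ind_int: "integrable (FX \<Otimes>\<^sub>M FY) (indicator (defender_wins W) :: _ \<Rightarrow> real)"
    using wins by (simp add: emeasure_eq_measure)
  have wins_section: "(LINT y|FY. indicator (defender_wins W) (x, y)) = measure FY {y. \<forall>i. y $ i \<le> v x i}" for x
  proof -
    have "indicator (defender_wins W) (x, y) = (indicator {y. \<forall>i. y $ i \<le> v x i} y :: real)" for y
      by (simp add: defender_wins_def v_def indicator_def)
    then show ?thesis by simp
  qed
  have "defender_payoff W FX FY = (LINT x|FX. LINT y|FY. indicator (defender_wins W) (x, y))"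
    unfolding defender_payoff_def by (rule integral_fst'[OF ind_int, symmetric])
  also have "\<dots> \<le> (LINT x|FX. a + b * (\<Sum>i\<in>UNIV. (p $ i)\<^sup>2 * (v x i / Y $ i)))"
  proof (rule integral_mono_AE)
    show "integrable FX (\<lambda>x. LINT y|FY. indicator (defender_wins W) (x, y) :: real)"
      by (rule integrable_fst'[OF ind_int])
    show "integrable FX (\<lambda>x. a + b * (\<Sum>i\<in>UNIV. (p $ i)\<^sup>2 * (v x i / Y $ i)))"
      using v_int by simp
    \<comment> \<open>\<open>bound\<close> covers nonnegative defences only; these arise for almost
      every \<open>x\<close>, since \<open>W\<close> is nonnegative too.\<close>
    show "AE x in FX. (LINT y|FY. indicator (defender_wins W) (x, y)) \<le> a + b * (\<Sum>i\<in>UNIV. (p $ i)\<^sup>2 * (v x i / Y $ i))"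
      using nonneg
    proof eventually_elim
      case (elim x)
      then show ?case unfolding wins_section
        by (intro bound) (auto simp: v_def W sum_nonneg)
    qed
  qed
  also have "\<dots> = a + b * g W X Y p S"
    using v_int FX.prob_space by (simp add: v_mean g_def)
  finally show ?thesis using that S by blast
qed

theorem theorem2:
  fixes W :: "real ^ 'n ^ 'm" and X :: "real ^ 'm" and Y :: "real ^ 'n"
  assumes "\<And>j i. W $ j $ i \<ge> 0"
    and "\<And>j. X $ j > 0"
    and "\<And>i. Y $ i > 0"
  shows "min_max_value W X Y \<le> UB W X Y"
proof -
  obtain p where p: "p \<in> prob_simplex" "(SUP S\<in>routing_matrices. g W X Y p S) = g_star W X Y"
    using g_star_attained[OF assms] by blast
  \<comment> \<open>The matrix \<open>S\<close> obtained below varies with \<open>FX\<close>; this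
    bound is uniform in it because \<open>p\<close> attains the outer minimum.\<close>
  have g_le: "g W X Y p S \<le> g_star W X Y" if "S \<in> routing_matrices" for S
    using g_max_attained[of W X Y p] p(2) that by auto
  \<comment> \<open>This \<open>c\<close> minimises
    \<open>1 - 1 / c + g_star W X Y / (2 * c\<^sup>2)\<close> over \<open>c \<ge> 1\<close>: the
    derivative in \<open>c\<close> changes sign at \<open>g_star W X Y\<close>. The two cases of the
    maximum give the two branches of \<open>UB\<close>.\<close>
  define c where "c = max 1 (g_star W X Y)"
  have c: "1 \<le> c" by (simp add: c_def)
  obtain FY where FY: "FY \<in> attacker_strategies Y" and
    FY_bound: "\<And>v. (\<And>i. 0 \<le> v i) \<Longrightarrow>
      measure FY {y. \<forall>i. y $ i \<le> v i} \<le> 1 - 1 / c + (\<Sum>i\<in>UNIV. (p $ i)\<^sup>2 * (v i / Y $ i)) / (2 * c\<^sup>2)"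
    using attacker_strategy_exists[OF assms(3) p(1) c] by blast
  have payoff_le: "defender_payoff W FX FY \<le> UB W X Y" if FX: "FX \<in> defender_strategies X" for FX
  proof -
    obtain S where S: "S \<in> routing_matrices"
      "defender_payoff W FX FY \<le> (1 - 1 / c) + 1 / (2 * c\<^sup>2) * g W X Y p S"
      by (rule defender_payoff_le_g[OF assms(1,2) FX FY, of "1 - 1 / c" "1 / (2 * c\<^sup>2)" p])
        (use FY_bound in auto)
    note S(2)
    also have "(1 - 1 / c) + 1 / (2 * c\<^sup>2) * g W X Y p S \<le> (1 - 1 / c) + 1 / (2 * c\<^sup>2) * g_star W X Y"
      by (intro add_left_mono mult_left_mono g_le S(1)) simp
    also have "\<dots> = UB W X Y"
      by (auto simp: UB_def c_def max_def power2_eq_square field_simps)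
    finally show ?thesis .
  qed
  let ?V = "\<lambda>FY. SUP FX\<in>defender_strategies X. defender_payoff W FX FY"
  \<comment> \<open>A real infimum lies below its members only if the set is bounded below; 0 is
    such a bound, as some defender strategy exists and payoffs lie between 0 and 1.\<close>
  have V_nonneg: "0 \<le> ?V FY'" if FY': "FY' \<in> attacker_strategies Y" for FY'
  proof -
    obtain FX :: "(real ^ 'm ^ 'n) measure" where FX: "FX \<in> defender_strategies X"
      using defender_strategies_nonempty[OF assms(2)] by blast
    have "bdd_above ((\<lambda>FX. defender_payoff W FX FY') ` defender_strategies X)"
      using defender_payoff_bounds(2)[OF _ FY'] by (intro bdd_aboveI[of _ 1]) auto
    then show ?thesis
      using defender_payoff_bounds(1)[OF FX FY'] by (rule cSUP_upper2[OF _ FX])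
  qed
  have "min_max_value W X Y \<le> ?V FY"
    unfolding min_max_value_def
    by (rule cINF_lower[OF _ FY], rule bdd_belowI[of _ 0]) (use V_nonneg in auto)
  also have "\<dots> \<le> UB W X Y"
    by (rule cSUP_least[OF defender_strategies_nonempty[OF assms(2)] payoff_le])
  finally show ?thesis .
qed

end
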